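(* Consider the system $\dot x=f(x)$, $y=h(x)$, with $f:\mathbb{R}^{n_x}\to\mathbb{R}^{n_x}$ locally Lipschitz and $h:\mathbb{R}^{n_x}\to\mathbb{R}^{n_y}$ continuous. Let $\mathcal{O}\subset\mathbb{R}^{n_x}$, let $\mathcal{X}\subset\mathcal{O}$ be compact, let $A\in\mathbb{R}^{n_z\times n_z}$ be Hurwitz and $B\in\mathbb{R}^{n_z\times n_y}$, and let $T:\mathcal{O}\to\mathbb{R}^{n_z}$ be a $C^1$ map such that $$\frac{\partial T}{\partial x}(x) f(x) = A T(x) + B h(x)\qquad \forall x\in\mathcal{X}.$$ For $z\in T(\mathcal{X})$ let $T^-(z):=\{x\in\mathcal{X}:T(x)=z\}$. Assume that: (1) there exists an integer $p\ge1$ such that $\mathrm{card}(T^-(z))=p$ for every $z\in T(\mathcal{X})$; (2) for each $x\in\mathcal{X}$, the Jacobian matrix $\frac{\partial T}{\partial x}(x)$ has full rank $n_x$. Let $y:\mathbb{R}_{\ge0}\to\mathbb{R}^{n_y}$ be an output of the system such that there exist $\bar t>0$ and at least $p$ solutions $x_1,\dots,x_p:[\bar t,+\infty)\to\mathcal{X}$ to $\dot x=f(x)$ (with $p$ as in (1)) satisfying: (3) $h(x_i(t))=y(t)$ for all $t\ge\bar t$ and all $i\in\{1,\dots,p\}$; (4) $\liminf_{t\to\infty}|x_i(t)-x_j(t)|>0$ for all $i,j\in\{1,\dots,p\}$ with $i\neq j$. Then $$T^-(T(x))\subseteq\mathcal{I}_{\mathcal{X}}(x)\qquad\forall x\in\omega(x_1(\bar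 t)).$$
   Context: Backward indistinguishability: two points $x_a,x_b\in\mathbb{R}^{n_x}$ satisfy $x_a\sim x_b$ if the maximal backward solutions $\phi_a:(-\sigma_a,0]\to\mathbb{R}^{n_x}$ and $\phi_b:(-\sigma_b,0]\to\mathbb{R}^{n_x}$ of $\dot x=f(x)$ with $\phi_a(0)=x_a$, $\phi_b(0)=x_b$ verify $h(\phi_a(t))=h(\phi_b(t))$ for all $t\in(-\min\{\sigma_a,\sigma_b\},0]$. For $x\in\mathbb{R}^{n_x}$, $\mathcal{I}_{\mathcal{X}}(x):=\{x'\in\mathcal{X}:x'\sim x\}$. For $x_0\in\mathbb{R}^{n_x}$, $\omega(x_0)$ denotes the $\omega$-limit set $\{\xi:\forall s>0,\ \forall\varepsilon>0,\ \exists t>s:|\phi(t)-\xi|<\varepsilon\}$, where $\phi$ is the maximal solution of $\dot x=f(x)$ with $\phi(0)=x_0$. A square matrix is Hurwitz if all its eigenvalues have negative real part. *)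

theory Defs
  imports "HOL-Analysis.Analysis"
begin

definition ode_solution :: "('a::real_normed_vector \<Rightarrow> 'a) \<Rightarrow> real set \<Rightarrow> (real \<Rightarrow> 'a) \<Rightarrow> bool" where
  "ode_solution f J \<phi> \<longleftrightarrow> (\<forall>t\<in>J. (\<phi> has_vector_derivative f (\<phi> t)) (at t within J))"

(* W is the set of admissible times: UNIV for maximal solutions, {..0} for maximal backward
   solutions. Only the values of \<phi> on J matter. *)
definition maximal_solution ::
  "('a::real_normed_vector \<Rightarrow> 'a) \<Rightarrow> real set \<Rightarrow> 'a \<Rightarrow> real set \<Rightarrow> (real \<Rightarrow> 'a) \<Rightarrow> bool" where
  "maximal_solution f W x0 J \<phi> \<longleftrightarrow>
     is_interval J \<and> J \<subseteq> W \<and> 0 \<in> J \<and> \<phi> 0 = x0 \<and> ode_solution f J \<phi> \<and>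
     \<not> (\<exists>J' \<psi>. is_interval J' \<and> J \<subset> J' \<and> J' \<subseteq> W \<and> ode_solution f J' \<psi> \<and> (\<forall>t\<in>J. \<psi> t = \<phi> t))"

definition backward_interval :: "ereal \<Rightarrow> real set" where
  "backward_interval \<sigma> = {t. - \<sigma> < ereal t \<and> t \<le> 0}"

(* For locally Lipschitz f the maximal (backward) solution from a point exists and is unique on its
   interval, so the existential quantifiers below and in omega_limit only name that solution. *)
definition backward_indist ::
  "('a::real_normed_vector \<Rightarrow> 'a) \<Rightarrow> ('a \<Rightarrow> 'b) \<Rightarrow> 'a \<Rightarrow> 'a \<Rightarrow> bool" where
  "backward_indist f h xa xb \<longleftrightarrow>
     (\<exists>\<sigma>a \<sigma>b \<phi>a \<phi>b. 0 < \<sigma>a \<and> 0 < \<sigma>b \<and>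
        maximal_solution f {..0} xa (backward_interval \<sigma>a) \<phi>a \<and>
        maximal_solution f {..0} xb (backward_interval \<sigma>b) \<phi>b \<and>
        (\<forall>t \<in> backward_interval (min \<sigma>a \<sigma>b). h (\<phi>a t) = h (\<phi>b t)))"

definition indist_class ::
  "('a::real_normed_vector \<Rightarrow> 'a) \<Rightarrow> ('a \<Rightarrow> 'b) \<Rightarrow> 'a set \<Rightarrow> 'a \<Rightarrow> 'a set" where
  "indist_class f h X x = {x' \<in> X. backward_indist f h x' x}"

definition omega_limit :: "('a::real_normed_vector \<Rightarrow> 'a) \<Rightarrow> 'a \<Rightarrow> 'a set" where
  "omega_limit f x0 = {\<xi>. \<exists>J \<phi>. maximal_solution f UNIV x0 J \<phi> \<and>
     (\<forall>s>0. \<forall>\<epsilon>>0. \<exists>t\<in>J. t > s \<and> norm (\<phi> t - \<xi>) < \<epsilon>)}"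

definition hurwitz :: "real^'n^'n \<Rightarrow> bool" where
  "hurwitz A \<longleftrightarrow>
     (\<forall>(\<mu>::complex) (v::complex^'n).
        v \<noteq> 0 \<and> map_matrix complex_of_real A *v v = \<mu> *s v \<longrightarrow> Re \<mu> < 0)"

(* The Jacobian DT is an explicit argument because S need not be open. For open S, "at x within S"
   is "at x", so this is the usual notion of a C^1 map and DT is its unique Jacobian. If T is the
   restriction of a C^1 map on an open superset of S, the Jacobian of that map qualifies as DT. *)
definition C1_map_on :: "(real^'n) set \<Rightarrow> (real^'n \<Rightarrow> real^'m) \<Rightarrow> (real^'n \<Rightarrow> real^'n^'m) \<Rightarrow> bool" where
  "C1_map_on S T DT \<longleftrightarrow>
     (\<forall>x\<in>S. (T has_derivative (\<lambda>v. DT x *v v)) (at x within S)) \<and> continuous_on S DT"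

definition fiber :: "'a set \<Rightarrow> ('a \<Rightarrow> 'b) \<Rightarrow> 'b \<Rightarrow> 'a set" where
  "fiber X T z = {x \<in> X. T x = z}"

definition system_output ::
  "('a::real_normed_vector \<Rightarrow> 'a) \<Rightarrow> ('a \<Rightarrow> 'b) \<Rightarrow> (real \<Rightarrow> 'b) \<Rightarrow> bool" where
  "system_output f h y \<longleftrightarrow> (\<exists>x. ode_solution f {0..} x \<and> (\<forall>t\<ge>0. y t = h (x t)))"

end

(* The differences T (x i) - T (x 1) satisfy e' = A e, so they vanish at infinity. Along times \<tau> n
   with x 1 (\<tau> n) \<longlonglongrightarrow> \<xi>, compactness yields limits l i of x i (\<tau> n). They all have the same image under T and
   are pairwise distinct by separation, so these p points exhaust the fiber of T \<xi>. By Gronwall's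
   inequality the curves s \<mapsto> x i (\<tau> n + s) converge, locally uniformly in s \<le> 0, to complete backward solutions
   through the l i, which stay in X and share the output lim y (\<tau> n + s).

   The decay e \<longlonglongrightarrow> 0 is obtained without matrix exponentials or Jordan forms: a nonzero complex polynomial
   annihilates A, and one splits off one linear factor A - \<mu> at a time. The input w = (A - \<mu>) e tends to 0
   by induction. If Re \<mu> < 0, then e' = \<mu> e + w forces e \<longlonglongrightarrow> 0. Otherwise \<mu> is not an eigenvalue,
   so A - \<mu> is injective, hence bounded below, and e inherits the decay of w. *)
theory Submission
  imports Defs "HOL-Computational_Algebra.Fundamental_Theorem_Algebra"
begin

section \<open>Differential inequalities: Gronwall bounds and decay\<close>

lemma has_real_derivative_inner_self:
  fixes w :: "real \<Rightarrow> 'a::real_inner"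
  assumes "(w has_vector_derivative d) (at t within S)"
  shows "((\<lambda>t. w t \<bullet> w t) has_real_derivative 2 * (w t \<bullet> d)) (at t within S)"
proof -
  have "((\<lambda>t. w t \<bullet> w t) has_derivative (\<lambda>h. w t \<bullet> (h *\<^sub>R d) + (h *\<^sub>R d) \<bullet> w t)) (at t within S)"
    using assms unfolding has_vector_derivative_def by (intro has_derivative_inner)
  then show ?thesis
    by (rule has_derivative_imp_has_field_derivative) (simp add: inner_commute)
qed

text \<open>The squared norm is used because it is differentiable even where \<open>w\<close>
  vanishes. By Cauchy-Schwarz its derivative is at most 2 L |w|^2 in absolute value, so |w|^2 exp (-
  2 L t) is nonincreasing and |w|^2 exp (2 L t) is nondecreasing. The second conclusion controls the
  past by the present and is what backward convergence rests on.\<close>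

lemma gronwall_norm_le:
  fixes w :: "real \<Rightarrow> 'a::real_inner"
  assumes "a \<le> b"
    and deriv: "\<And>t. t \<in> {a..b} \<Longrightarrow> (w has_vector_derivative w' t) (at t within {a..b})"
    and bound: "\<And>t. t \<in> {a..b} \<Longrightarrow> norm (w' t) \<le> L * norm (w t)"
  shows "norm (w b) \<le> exp (L * (b - a)) * norm (w a)"
    and "norm (w a) \<le> exp (L * (b - a)) * norm (w b)"
proof -
  have deriv_at: "(w has_vector_derivative w' t) (at t)" if "a < t" "t < b" for t
    using deriv[of t] that at_within_Icc_at[of a t b] by auto
  have cont: "continuous_on {a..b} w"
    using deriv by (meson continuous_on_eq_continuous_within has_vector_derivative_continuous)
  have inner_bound: "\<bar>w t \<bullet> w' t\<bar> \<le> L * (w t \<bullet> w t)" if "t \<in> {a..b}" for t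
  proof -
    have "\<bar>w t \<bullet> w' t\<bar> \<le> norm (w t) * norm (w' t)"
      by (rule Cauchy_Schwarz_ineq2)
    also have "\<dots> \<le> norm (w t) * (L * norm (w t))"
      using bound[OF that] by (intro mult_left_mono) auto
    finally show ?thesis
      by (simp add: dot_square_norm power2_eq_square mult_ac)
  qed
  have deriv_weighted: "((\<lambda>t. (w t \<bullet> w t) * exp (c * t)) has_real_derivative
      (2 * (w t \<bullet> w' t) + c * (w t \<bullet> w t)) * exp (c * t)) (at t)" if "a < t" "t < b" for t c
    by (rule derivative_eq_intros has_real_derivative_inner_self[OF deriv_at[OF that]] refl)+
       (simp add: algebra_simps)
  have cont_weighted: "continuous_on {a..b} (\<lambda>t. (w t \<bullet> w t) * exp (c * t))" for c
    by (intro continuous_intros cont)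
  \<comment> \<open>Takes the square root of a comparison of weighted squares; \<open>r\<close> and
    \<open>s\<close> stand for the exponents at the two end points.\<close>
  have sq: "u \<le> exp (L * (b - a)) * v"
    if "u\<^sup>2 * exp r \<le> v\<^sup>2 * exp s" "v \<ge> 0" "s - r = 2 * L * (b - a)" for u v r s :: real
  proof (rule power2_le_imp_le)
    have "u\<^sup>2 * exp r \<le> (v\<^sup>2 * exp (s - r)) * exp r"
      using that(1) by (simp add: exp_diff)
    then have "u\<^sup>2 \<le> v\<^sup>2 * exp (s - r)"
      by simp
    then show "u\<^sup>2 \<le> (exp (L * (b - a)) * v)\<^sup>2"
      by (simp add: that(3) power_mult_distrib power2_eq_square[of "exp _"] mult_exp_exp mult_ac)
  qed (use that in auto)
  have "(w b \<bullet> w b) * exp (- 2 * L * b) \<le> (w a \<bullet> w a) * exp (- 2 * L * a)"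
  proof (rule DERIV_nonpos_imp_decreasing_open[OF \<open>a \<le> b\<close> _ cont_weighted])
    fix t assume t: "a < t" "t < b"
    have "(2 * (w t \<bullet> w' t) + (- 2 * L) * (w t \<bullet> w t)) * exp (- 2 * L * t) \<le> 0"
      using inner_bound[of t] t by (intro mult_nonpos_nonneg) auto
    then show "\<exists>y. ((\<lambda>t. (w t \<bullet> w t) * exp (- 2 * L * t)) has_real_derivative y) (at t) \<and> y \<le> 0"
      using deriv_weighted[OF t, of "- 2 * L"] by blast
  qed
  then show "norm (w b) \<le> exp (L * (b - a)) * norm (w a)"
    by (intro sq[of _ "- 2 * L * b" _ "- 2 * L * a"]) (auto simp: dot_square_norm algebra_simps)
  have "(w a \<bullet> w a) * exp (2 * L * a) \<le> (w b \<bullet> w b) * exp (2 * L * b)"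
  proof (rule DERIV_nonneg_imp_increasing_open[OF \<open>a \<le> b\<close> _ cont_weighted])
    fix t assume t: "a < t" "t < b"
    have "(2 * (w t \<bullet> w' t) + (2 * L) * (w t \<bullet> w t)) * exp (2 * L * t) \<ge> 0"
      using inner_bound[of t] t by (intro mult_nonneg_nonneg) auto
    then show "\<exists>y. ((\<lambda>t. (w t \<bullet> w t) * exp (2 * L * t)) has_real_derivative y) (at t) \<and> y \<ge> 0"
      using deriv_weighted[OF t, of "2 * L"] by blast
  qed
  then show "norm (w a) \<le> exp (L * (b - a)) * norm (w b)"
    by (intro sq[of _ "2 * L * a" _ "2 * L * b"]) (auto simp: dot_square_norm algebra_simps)
qed

text \<open>As soon as \<open>r t\<close> stays below c \<delta>, the product (g - \<delta>) exp (c
  t) is nonincreasing. Hence \<open>g\<close> is at most \<delta> plus a decaying exponential, and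
  with \<delta> = \<epsilon> / 2 it eventually drops below \<epsilon>.\<close>

lemma decay_differential_inequality:
  fixes g :: "real \<Rightarrow> real"
  assumes "c > 0"
    and nonneg: "\<And>t. g t \<ge> 0"
    and deriv: "\<And>t. t > a \<Longrightarrow> (g has_real_derivative g' t) (at t)"
    and bound: "\<And>t. t > a \<Longrightarrow> g' t \<le> - c * g t + r t"
    and r: "(r \<longlongrightarrow> 0) at_top"
  shows "(g \<longlongrightarrow> 0) at_top"
proof (rule tendstoI)
  fix \<epsilon> :: real assume "\<epsilon> > 0"
  define \<delta> where "\<delta> = \<epsilon> / 2"
  have "\<delta> > 0" using \<open>\<epsilon> > 0\<close> by (simp add: \<delta>_def)
  have "\<forall>\<^sub>F t in at_top. r t < c * \<delta>"
    using r \<open>c > 0\<close> \<open>\<delta> > 0\<close> by (intro order_tendstoD(2)) auto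
  then obtain s0 where s0: "\<And>t. t \<ge> s0 \<Longrightarrow> r t < c * \<delta>"
    by (auto simp: eventually_at_top_linorder)
  \<comment> \<open>The bound a + 1 keeps \<open>s\<close> strictly above \<open>a\<close>, where
    the derivative of \<open>g\<close> is available.\<close>
  define s where "s = max s0 (a + 1)"
  have decr: "(g t - \<delta>) * exp (c * t) \<le> (g s - \<delta>) * exp (c * s)" if "t \<ge> s" for t
  proof (rule DERIV_nonpos_imp_nonincreasing[OF that])
    fix u assume u: "s \<le> u" "u \<le> t"
    have "((\<lambda>t. (g t - \<delta>) * exp (c * t)) has_real_derivative
        (g' u + c * (g u - \<delta>)) * exp (c * u)) (at u)"
      using u by (auto simp: s_def algebra_simps intro!: derivative_eq_intros deriv)
    moreover have "(g' u + c * (g u - \<delta>)) * exp (c * u) \<le> 0"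
      using bound[of u] s0[of u] u by (intro mult_nonpos_nonneg) (auto simp: s_def algebra_simps)
    ultimately show "\<exists>y. ((\<lambda>t. (g t - \<delta>) * exp (c * t)) has_real_derivative y) (at u) \<and> y \<le> 0"
      by blast
  qed
  define C where "C = (g s - \<delta>) * exp (c * s)"
  have le: "g t \<le> \<delta> + C * exp (- c * t)" if "t \<ge> s" for t
    using decr[OF that] unfolding C_def[symmetric] by (simp add: exp_minus field_simps)
  have "((\<lambda>t. exp (- c * t)) \<longlongrightarrow> 0) at_top"
    using \<open>c > 0\<close>
    by (intro filterlim_compose[OF exp_at_bot]
        filterlim_tendsto_neg_mult_at_bot[OF tendsto_const _ filterlim_ident]) simp
  then have "((\<lambda>t. C * exp (- c * t)) \<longlongrightarrow> 0) at_top"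
    by (rule tendsto_mult_right_zero)
  then have "\<forall>\<^sub>F t in at_top. C * exp (- c * t) < \<delta>"
    using \<open>\<delta> > 0\<close> by (intro order_tendstoD(2)) auto
  then show "\<forall>\<^sub>F t in at_top. dist (g t) 0 < \<epsilon>"
    using eventually_ge_at_top[of s]
  proof eventually_elim
    case (elim t)
    then show ?case using le[of t] nonneg[of t] by (simp add: \<delta>_def)
  qed
qed

text \<open>The inner product on \<open>complex^'m\<close> is the real part of the Hermitian one, so
  multiplication by i Im \<mu> turns a vector into an orthogonal one and contributes
  nothing.\<close>

lemma inner_vector_scalar_mult_self:
  fixes v :: "complex^'m"
  shows "v \<bullet> (\<mu> *s v) = Re \<mu> * (v \<bullet> v)"
  by (simp add: inner_vec_def inner_complex_def sum_distrib_left algebra_simps)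

text \<open>With c = - Re \<mu>, the squared norm of \<open>e\<close> has derivative - 2 c |e|^2 + 2
  (e, w). Expanding the square of c e - w bounds the cross term by c |e|^2 + |w|^2 / c. Half of the
  damping survives, and the remaining input |w|^2 / c vanishes at infinity.\<close>

lemma decay_scalar_with_vanishing_input:
  fixes e w :: "real \<Rightarrow> complex^'m"
  assumes "Re \<mu> < 0"
    and deriv: "\<And>t. t > a \<Longrightarrow> (e has_vector_derivative \<mu> *s e t + w t) (at t)"
    and w: "(w \<longlongrightarrow> 0) at_top"
  shows "(e \<longlongrightarrow> 0) at_top"
proof -
  define c where "c = - Re \<mu>"
  have "c > 0" using assms(1) by (simp add: c_def)
  have "((\<lambda>t. e t \<bullet> e t) \<longlongrightarrow> 0) at_top"
  proof (rule decay_differential_inequality[OF \<open>c > 0\<close>])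
    fix t assume "t > a"
    show "((\<lambda>t. e t \<bullet> e t) has_real_derivative 2 * (e t \<bullet> (\<mu> *s e t + w t))) (at t)"
      by (rule has_real_derivative_inner_self[OF deriv[OF \<open>t > a\<close>]])
    have young: "2 * (e t \<bullet> w t) \<le> c * (e t \<bullet> e t) + (w t \<bullet> w t) / c"
    proof -
      have "0 \<le> (c *\<^sub>R e t - w t) \<bullet> (c *\<^sub>R e t - w t)" by simp
      also have "\<dots> = c * (c * (e t \<bullet> e t) + (w t \<bullet> w t) / c - 2 * (e t \<bullet> w t))"
        using \<open>c > 0\<close> by (simp add: inner_diff_left inner_diff_right inner_commute algebra_simps)
      finally show ?thesis
        using \<open>c > 0\<close> by (simp add: zero_le_mult_iff)
    qed
    then show "2 * (e t \<bullet> (\<mu> *s e t + w t)) \<le> - c * (e t \<bullet> e t) + (w t \<bullet> w t) / c"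
      by (simp add: inner_add_right inner_vector_scalar_mult_self c_def algebra_simps)
  next
    have "((\<lambda>t. (w t \<bullet> w t) / c) \<longlongrightarrow> (0 \<bullet> (0 :: complex^'m)) / c) at_top"
      using \<open>c > 0\<close> by (intro tendsto_intros w) auto
    then show "((\<lambda>t. (w t \<bullet> w t) / c) \<longlongrightarrow> 0) at_top" by simp
  qed simp
  then have "((\<lambda>t. sqrt (e t \<bullet> e t)) \<longlongrightarrow> sqrt 0) at_top"
    by (rule tendsto_real_sqrt)
  then show ?thesis
    by (simp add: norm_eq_sqrt_inner[symmetric] tendsto_norm_zero_iff)
qed

section \<open>Polynomials in a matrix and decay for Hurwitz matrices\<close>

definition poly_matrix_apply :: "complex^'m^'m \<Rightarrow> complex poly \<Rightarrow> complex^'m \<Rightarrow> complex^'m" where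
  "poly_matrix_apply M q v = (\<Sum>i\<le>degree q. coeff q i *s (((*v) M ^^ i) v))"

text \<open>Allowing a summation bound above the degree lets a polynomial be evaluated without
  knowing its exact degree.\<close>

lemma poly_matrix_apply_eq:
  assumes "degree q \<le> N"
  shows "poly_matrix_apply M q v = (\<Sum>i\<le>N. coeff q i *s (((*v) M ^^ i) v))"
  unfolding poly_matrix_apply_def
  by (rule sum.mono_neutral_left) (use assms in \<open>auto simp: coeff_eq_0\<close>)

lemma funpow_matrix_diff_smult:
  fixes M :: "complex^'m^'m"
  shows "((*v) M ^^ i) (v - c *s w) = ((*v) M ^^ i) v - c *s (((*v) M ^^ i) w)"
  by (induction i) (simp_all add: matrix_vector_mult_diff_distrib vector_scalar_commute)

text \<open>Dropping the factor X - \<mu> from the polynomial amounts to replacing \<open>v\<close>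
  by (M - \<mu>) v, because \<open>M\<close> commutes with its own powers. This drives the induction
  on the degree.\<close>

lemma poly_matrix_apply_linear_factor:
  "poly_matrix_apply M ([:- \<mu>, 1:] * q) v = poly_matrix_apply M q (M *v v - \<mu> *s v)"
proof -
  let ?N = "degree q" and ?p = "\<lambda>i. ((*v) M ^^ i) v"
  have "degree ([:- \<mu>, 1:] * q) \<le> Suc ?N"
    by (rule order_trans[OF degree_mult_le]) simp
  then have "poly_matrix_apply M ([:- \<mu>, 1:] * q) v =
      (\<Sum>i\<le>Suc ?N. coeff ([:- \<mu>, 1:] * q) i *s ?p i)"
    by (rule poly_matrix_apply_eq)
  also have "\<dots> = (\<Sum>i\<le>Suc ?N. coeff (pCons 0 q) i *s ?p i) - (\<Sum>i\<le>Suc ?N. \<mu> *s (coeff q i *s ?p i))"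
    by (simp add: sum_subtractf[symmetric] algebra_simps vector_sadd_rdistrib vector_smult_lneg
        del: sum.atMost_Suc)
  \<comment> \<open>Multiplication by X shifts the coefficients, and the term of index 0 is
    zero.\<close>
  also have "(\<Sum>i\<le>Suc ?N. coeff (pCons 0 q) i *s ?p i) = (\<Sum>i\<le>?N. coeff q i *s ?p (Suc i))"
    by (subst sum.atMost_Suc_shift) simp
  \<comment> \<open>The extra top term vanishes because its index exceeds the degree of
    \<open>q\<close>.\<close>
  also have "(\<Sum>i\<le>Suc ?N. \<mu> *s (coeff q i *s ?p i)) = (\<Sum>i\<le>?N. \<mu> *s (coeff q i *s ?p i))"
    by (simp add: coeff_eq_0)
  also have "(\<Sum>i\<le>?N. coeff q i *s ?p (Suc i)) - (\<Sum>i\<le>?N. \<mu> *s (coeff q i *s ?p i)) =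
      poly_matrix_apply M q (M *v v - \<mu> *s v)"
    unfolding poly_matrix_apply_def sum_subtractf[symmetric]
    by (simp add: funpow_matrix_diff_smult vector_ssub_ldistrib funpow_swap1 mult_ac)
  finally show ?thesis .
qed

text \<open>The induction varies \<open>e\<close> together with \<open>q\<close>: if
  \<open>r\<close> is the cofactor of X - \<mu> in \<open>q\<close>, then w = (M - \<mu>) e solves
  the same equation and is annihilated by \<open>r\<close>.\<close>

lemma decay_of_annihilated_solution:
  fixes M :: "complex^'m^'m" and e :: "real \<Rightarrow> complex^'m"
  assumes eigen: "\<And>\<mu> v. v \<noteq> 0 \<Longrightarrow> M *v v = \<mu> *s v \<Longrightarrow> Re \<mu> < 0"
    and "q \<noteq> 0"
    and "\<And>t. t > a \<Longrightarrow> (e has_vector_derivative M *v e t) (at t)"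
    and "\<And>t. t > a \<Longrightarrow> poly_matrix_apply M q (e t) = 0"
  shows "(e \<longlongrightarrow> 0) at_top"
  using assms(2-)
proof (induction "degree q" arbitrary: q e)
  \<comment> \<open>A nonzero constant polynomial annihilates only the zero vector, so
    \<open>e\<close> is identically 0 after \<open>a\<close>.\<close>
  case 0
  then have "coeff q 0 \<noteq> 0"
    by (metis leading_coeff_neq_0)
  then have "e t = 0" if "t > a" for t
    using "0.prems"(3)[OF that] "0.hyps" by (simp add: poly_matrix_apply_def)
  then show ?case
    by (intro tendsto_eventually eventually_at_top_linorderI[of "a + 1"]) auto
next
  case (Suc k)
  then obtain \<mu> where "poly q \<mu> = 0"
    using alg_closed_imp_poly_has_root[of q] by auto
  then obtain r where r: "q = [:- \<mu>, 1:] * r"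
    by (auto simp: poly_eq_0_iff_dvd)
  with \<open>q \<noteq> 0\<close> have "r \<noteq> 0" by auto
  with r Suc have "k = degree r"
    by (simp add: degree_mult_eq del: mult_pCons_left)
  define w where "w t = M *v e t - \<mu> *s e t" for t
  have "bounded_linear ((*s) \<mu> :: complex^'m \<Rightarrow> complex^'m)"
    unfolding linear_conv_bounded_linear[symmetric] by (simp add: linear_iff vec_eq_iff algebra_simps)
  then have lin: "bounded_linear (\<lambda>v. M *v v - \<mu> *s v)"
    by (intro bounded_linear_sub matrix_vector_mul_bounded_linear)
  have "(w \<longlongrightarrow> 0) at_top"
  proof (rule Suc.hyps(1)[OF \<open>k = degree r\<close> \<open>r \<noteq> 0\<close>])
    fix t assume "t > a"
    have "(w has_vector_derivative (M *v (M *v e t) - \<mu> *s (M *v e t))) (at t)"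
      unfolding w_def
      by (rule bounded_linear.has_vector_derivative[OF lin Suc.prems(2)[OF \<open>t > a\<close>]])
    then show "(w has_vector_derivative M *v w t) (at t)"
      by (simp add: w_def matrix_vector_mult_diff_distrib vector_scalar_commute)
    show "poly_matrix_apply M r (w t) = 0"
      using Suc.prems(3)[OF \<open>t > a\<close>] by (simp only: w_def r poly_matrix_apply_linear_factor)
  qed
  show ?case
  proof (cases "Re \<mu> < 0")
    case True
    then show ?thesis
      by (rule decay_scalar_with_vanishing_input[OF _ _ \<open>(w \<longlongrightarrow> 0) at_top\<close>, where a = a])
         (use Suc.prems(2) in \<open>simp add: w_def\<close>)
  next
    \<comment> \<open>The polynomial need not be minimal, so its root \<mu> may fail to be an
      eigenvalue. Here it must fail, since \<open>eigen\<close> places every eigenvalue in the open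
      left half plane.\<close>
    case False
    have "inj (\<lambda>v. M *v v - \<mu> *s v)"
      using eigen[of _ \<mu>] False
      by (subst linear_injective_0[OF bounded_linear.linear[OF lin]]) auto
    then obtain b where b: "b > 0" "\<And>v. b * norm v \<le> norm (M *v v - \<mu> *s v)"
      using linear_inj_bounded_below_pos[OF bounded_linear.linear[OF lin]] by blast
    show ?thesis
    proof (rule Lim_null_comparison)
      show "\<forall>\<^sub>F t in at_top. norm (e t) \<le> norm (w t) / b"
        using b by (auto simp: w_def field_simps)
      show "((\<lambda>t. norm (w t) / b) \<longlongrightarrow> 0) at_top"
        using \<open>(w \<longlongrightarrow> 0) at_top\<close> by (intro tendsto_divide_zero tendsto_norm_zero)
    qed
  qed
qed

text \<open>One vector more than the dimension is linearly dependent. Since \<open>dependent\<close>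
  speaks of sets, a repetition in the sequence is treated separately, with coefficients 1 and -1 at
  the two equal entries.\<close>

lemma ex_nontrivial_combination:
  fixes v :: "nat \<Rightarrow> 'a::euclidean_space"
  obtains c N where "(\<Sum>i\<le>N. c i *\<^sub>R v i) = 0" and "\<exists>i\<le>N. c i \<noteq> 0"
proof (cases "inj_on v {..DIM('a)}")
  case True
  then have "card (v ` {..DIM('a)}) = Suc DIM('a)"
    by (simp add: card_image)
  then have "dependent (v ` {..DIM('a)})"
    using independent_card_le[of "v ` {..DIM('a)}"] by auto
  then obtain u where u: "\<exists>x\<in>v ` {..DIM('a)}. u x \<noteq> 0" "(\<Sum>x\<in>v ` {..DIM('a)}. u x *\<^sub>R x) = 0"
    by (subst (asm) dependent_finite) auto
  show ?thesis
    by (rule that[of "u \<circ> v" "DIM('a)"]) (use u True in \<open>auto simp: sum.reindex\<close>)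
next
  case False
  then obtain i j where ij: "i \<le> DIM('a)" "j \<le> DIM('a)" "i \<noteq> j" "v i = v j"
    by (auto simp: inj_on_def)
  let ?c = "\<lambda>k. (if k = i then 1 else 0) - (if k = j then 1 else (0::real))"
  have "(\<Sum>k\<le>DIM('a). ?c k *\<^sub>R v k) =
      (\<Sum>k\<le>DIM('a). (if k = i then v k else 0)) - (\<Sum>k\<le>DIM('a). (if k = j then v k else 0))"
    unfolding sum_subtractf[symmetric] by (rule sum.cong) auto
  also have "\<dots> = 0" using ij by simp
  finally show ?thesis
    by (rule that) (use ij in auto)
qed

text \<open>The powers of \<open>M\<close> lie in a finite-dimensional real vector space of
  matrices, so some nontrivial real combination of them vanishes; its coefficients form the
  polynomial.\<close>

lemma ex_annihilating_poly:
  fixes M :: "complex^'m^'m"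
  obtains q where "q \<noteq> 0" and "\<And>v. poly_matrix_apply M q v = 0"
proof -
  let ?P = "\<lambda>i. ((**) M ^^ i) (mat 1)"
  obtain c N where c: "(\<Sum>i\<le>N. c i *\<^sub>R ?P i) = 0" "\<exists>i\<le>N. c i \<noteq> 0"
    by (rule ex_nontrivial_combination)
  define q where "q = (\<Sum>i\<le>N. monom (complex_of_real (c i)) i)"
  have coeff: "coeff q i = (if i \<le> N then complex_of_real (c i) else 0)" for i
    by (simp add: q_def coeff_sum)
  have P: "?P i *v v = ((*v) M ^^ i) v" for i v
    by (induction i) (simp_all add: matrix_vector_mul_assoc[symmetric])
  show ?thesis
  proof
    show "q \<noteq> 0" using c(2) coeff by (metis coeff_0 of_real_eq_0_iff)
    fix v
    have "degree q \<le> N"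
      by (rule degree_le) (simp add: coeff)
    then have "poly_matrix_apply M q v = (\<Sum>i\<le>N. complex_of_real (c i) *s (?P i *v v))"
      by (simp add: poly_matrix_apply_eq coeff P)
    also have "\<dots> = (\<Sum>i\<le>N. c i *\<^sub>R ?P i) *v v"
    proof -
      have lin: "linear (\<lambda>Q :: complex^'m^'m. Q *v v)"
        by (simp add: linear_iff matrix_vector_mult_add_rdistrib vec_eq_iff matrix_vector_mult_def
            scaleR_sum_right distrib_right sum.distrib)
      moreover have "complex_of_real r *s u = r *\<^sub>R u" for r and u :: "complex^'m"
        by (simp add: vec_eq_iff scaleR_conv_of_real[symmetric])
      ultimately show ?thesis
        by (simp add: linear_sum[OF lin] linear_cmul[OF lin])
    qed
    finally show "poly_matrix_apply M q v = 0" by (simp add: c)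
  qed
qed

text \<open>The solution is complexified: \<open>?c\<close> is real linear, carries \<open>A\<close>
  to \<open>?M\<close> and preserves norms, so decay in the complex space gives decay in the real
  one.\<close>

lemma hurwitz_decay:
  fixes A :: "real^'m^'m" and e :: "real \<Rightarrow> real^'m"
  assumes "hurwitz A"
    and deriv: "\<And>t. t > a \<Longrightarrow> (e has_vector_derivative A *v e t) (at t)"
  shows "(e \<longlongrightarrow> 0) at_top"
proof -
  let ?M = "map_matrix complex_of_real A"
  let ?c = "\<lambda>v :: real^'m. \<chi> i. complex_of_real (v $ i)"
  obtain q where q: "q \<noteq> 0" "\<And>v. poly_matrix_apply ?M q v = 0"
    by (rule ex_annihilating_poly[of ?M]) blast
  have "linear ?c"
    by (auto simp: linear_iff vec_eq_iff complex_eq_iff)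
  have c_mult: "?c (A *v v) = ?M *v ?c v" for v
    by (simp add: vec_eq_iff matrix_vector_mult_def map_matrix_def)
  have "((\<lambda>t. ?c (e t)) \<longlongrightarrow> 0) at_top"
  proof (rule decay_of_annihilated_solution[where M = ?M])
    show "Re \<mu> < 0" if "v \<noteq> 0" "?M *v v = \<mu> *s v" for \<mu> v
      using assms(1) that unfolding hurwitz_def by blast
    show "((\<lambda>t. ?c (e t)) has_vector_derivative ?M *v ?c (e t)) (at t)" if "t > a" for t
      using bounded_linear.has_vector_derivative[OF _ deriv[OF that], of ?c] \<open>linear ?c\<close> c_mult
      by (simp add: linear_linear)
  qed (use q in auto)
  then have "((\<lambda>t. norm (?c (e t))) \<longlongrightarrow> 0) at_top"
    by (rule tendsto_norm_zero)
  then have "((\<lambda>t. norm (e t)) \<longlongrightarrow> 0) at_top"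
    by (simp add: norm_vec_def)
  then show ?thesis
    by (rule tendsto_norm_zero_cancel)
qed

section \<open>Lipschitz vector fields, comparison and uniqueness of solutions\<close>

lemma local_lipschitz_autonomous_compact:
  fixes f :: "'a::euclidean_space \<Rightarrow> 'a"
  assumes "local_lipschitz (UNIV :: real set) UNIV (\<lambda>_. f)" and "compact S"
  obtains L where "L-lipschitz_on S f"
proof -
  have "local_lipschitz {0::real} S (\<lambda>_. f)"
    by (rule local_lipschitz_subset[OF assms(1)]) auto
  then obtain L where "\<And>t. t \<in> {0::real} \<Longrightarrow> L-lipschitz_on S f"
    by (rule local_lipschitz_compact_implies_lipschitz[OF _ assms(2)]) auto
  then show ?thesis
    using that by blast
qed

lemma ode_solution_continuous_on:
  "ode_solution f J u \<Longrightarrow> continuous_on J u"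
  unfolding ode_solution_def continuous_on_eq_continuous_within
  using has_vector_derivative_continuous by blast

lemma ode_solution_subset:
  "ode_solution f J u \<Longrightarrow> J' \<subseteq> J \<Longrightarrow> ode_solution f J' u"
  unfolding ode_solution_def by (meson has_vector_derivative_within_subset subset_iff)

lemma ode_solution_shift:
  assumes "ode_solution f J u" and "(+) c ` J' \<subseteq> J"
  shows "ode_solution f J' (\<lambda>t. u (c + t))"
  unfolding ode_solution_def
proof
  fix t assume "t \<in> J'"
  with assms have "(u has_vector_derivative f (u (c + t))) (at (c + t) within (+) c ` J')"
    by (auto simp: ode_solution_def intro: has_vector_derivative_within_subset)
  moreover have "((+) c has_vector_derivative 1) (at t within J')"
    by (auto intro!: derivative_eq_intros)
  ultimately show "((\<lambda>t. u (c + t)) has_vector_derivative f (u (c + t))) (at t within J')"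
    using vector_diff_chain_within[of "(+) c" 1 t J' u] by (simp add: o_def)
qed

text \<open>Gronwall applied to the difference of two solutions. The forward bound serves
  uniqueness, the backward bound the convergence of shifted solutions.\<close>

lemma ode_solution_dist_le:
  fixes f :: "'a::real_inner \<Rightarrow> 'a"
  assumes L: "L-lipschitz_on S f" and "a \<le> b"
    and u: "ode_solution f {a..b} u" "u ` {a..b} \<subseteq> S"
    and v: "ode_solution f {a..b} v" "v ` {a..b} \<subseteq> S"
  shows "norm (u b - v b) \<le> exp (L * (b - a)) * norm (u a - v a)"
    and "norm (u a - v a) \<le> exp (L * (b - a)) * norm (u b - v b)"
proof -
  have "((\<lambda>t. u t - v t) has_vector_derivative f (u t) - f (v t)) (at t within {a..b})"
    if "t \<in> {a..b}" for t
    using u(1) v(1) that by (auto simp: ode_solution_def intro!: has_vector_derivative_diff)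
  moreover have "norm (f (u t) - f (v t)) \<le> L * norm (u t - v t)" if "t \<in> {a..b}" for t
    using lipschitz_onD[OF L, of "u t" "v t"] subsetD[OF u(2) imageI[OF that]]
      subsetD[OF v(2) imageI[OF that]] by (simp add: dist_norm)
  ultimately show "norm (u b - v b) \<le> exp (L * (b - a)) * norm (u a - v a)"
    "norm (u a - v a) \<le> exp (L * (b - a)) * norm (u b - v b)"
    using gronwall_norm_le[OF \<open>a \<le> b\<close>, of "\<lambda>t. u t - v t" "\<lambda>t. f (u t) - f (v t)" L] by blast+
qed

text \<open>The two trajectories over a compact interval together form a compact set, on which
  \<open>f\<close> has one Lipschitz constant; the forward bound then starts from distance
  0.\<close>

lemma ode_solution_unique_forward:
  fixes f :: "'a::euclidean_space \<Rightarrow> 'a"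
  assumes "local_lipschitz (UNIV :: real set) UNIV (\<lambda>_. f)" and "a \<le> b"
    and u: "ode_solution f {a..b} u" and v: "ode_solution f {a..b} v" and "u a = v a"
  shows "u b = v b"
proof -
  have "compact (u ` {a..b} \<union> v ` {a..b})"
    by (intro compact_Un compact_continuous_image ode_solution_continuous_on[OF u]
        ode_solution_continuous_on[OF v]) auto
  then obtain L where "L-lipschitz_on (u ` {a..b} \<union> v ` {a..b}) f"
    using local_lipschitz_autonomous_compact[OF assms(1)] by blast
  from ode_solution_dist_le(1)[OF this \<open>a \<le> b\<close> u _ v] \<open>u a = v a\<close> show ?thesis by auto
qed

section \<open>Omega-limit points and limits of time-shifted solutions\<close>

lemma omega_limit_sequence:
  fixes f :: "'a::euclidean_space \<Rightarrow> 'a"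
  assumes f: "local_lipschitz (UNIV :: real set) UNIV (\<lambda>_. f)"
    and u: "ode_solution f {a..} u"
    and \<xi>: "\<xi> \<in> omega_limit f (u a)"
  obtains \<tau> :: "nat \<Rightarrow> real"
  where "\<And>n. \<tau> n \<ge> a" "filterlim \<tau> at_top sequentially" "(\<lambda>n. u (\<tau> n)) \<longlonglongrightarrow> \<xi>"
proof -
  obtain J \<phi> where max: "maximal_solution f UNIV (u a) J \<phi>"
    and recur: "\<And>s \<epsilon>. s > 0 \<Longrightarrow> \<epsilon> > 0 \<Longrightarrow> \<exists>t\<in>J. t > s \<and> norm (\<phi> t - \<xi>) < \<epsilon>"
    using \<xi> unfolding omega_limit_def mem_Collect_eq by metis
  have J: "is_interval J" "0 \<in> J" "\<phi> 0 = u a" "ode_solution f J \<phi>"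
    using max unfolding maximal_solution_def by iprover+
  \<comment> \<open>By uniqueness, the solution witnessing membership in \<open>omega_limit\<close>
    is \<open>u\<close> shifted by \<open>a\<close>, so its recurrence times become times for
    \<open>u\<close> after adding \<open>a\<close>.\<close>
  have eq: "\<phi> t = u (a + t)" if "t \<in> J" "t \<ge> 0" for t
  proof (rule ode_solution_unique_forward[OF f \<open>t \<ge> 0\<close>])
    show "ode_solution f {0..t} \<phi>"
      using mem_is_interval_1_I[OF J(1,2) that(1)] by (intro ode_solution_subset[OF J(4)]) auto
    show "ode_solution f {0..t} (\<lambda>t. u (a + t))"
      by (rule ode_solution_shift[OF u]) auto
  qed (simp add: J)
  have "\<forall>n. \<exists>t\<in>J. t > real (Suc n) \<and> norm (\<phi> t - \<xi>) < inverse (real (Suc n))"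
    by (intro allI recur) auto
  then obtain \<theta> where \<theta>: "\<And>n. \<theta> n \<in> J" "\<And>n. \<theta> n > real (Suc n)"
    "\<And>n. norm (\<phi> (\<theta> n) - \<xi>) < inverse (real (Suc n))"
    by metis
  have \<theta>_pos: "\<theta> n \<ge> 0" for n
    using \<theta>(2)[of n] by linarith
  show ?thesis
  proof
    show "a + \<theta> n \<ge> a" for n
      using \<theta>_pos by simp
    have "filterlim \<theta> at_top sequentially"
      by (rule filterlim_at_top_mono[OF filterlim_real_sequentially])
         (use \<theta>(2) in \<open>auto intro!: always_eventually less_imp_le less_trans[OF _ \<theta>(2)]\<close>)
    then show "filterlim (\<lambda>n. a + \<theta> n) at_top sequentially"
      by (rule filterlim_tendsto_add_at_top[OF tendsto_const])
    have "(\<lambda>n. u (a + \<theta> n) - \<xi>) \<longlonglongrightarrow> 0"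
      by (rule Lim_null_comparison[OF _ LIMSEQ_inverse_real_of_nat])
         (use \<theta>(3) eq[OF \<theta>(1) \<theta>_pos] in \<open>auto intro!: always_eventually less_imp_le\<close>)
    then show "(\<lambda>n. u (a + \<theta> n)) \<longlonglongrightarrow> \<xi>"
      by (simp add: LIM_zero_iff)
  qed
qed

text \<open>The indices are handled one at a time: each new one refines the current subsequence, and
  the limits already found survive the refinement.\<close>

lemma compact_common_subsequence:
  fixes u :: "'i \<Rightarrow> nat \<Rightarrow> 'a::metric_space"
  assumes "compact S" and "finite I" and "\<And>i n. i \<in> I \<Longrightarrow> u i n \<in> S"
  shows "\<exists>r l. strict_mono (r :: nat \<Rightarrow> nat) \<and> (\<forall>i\<in>I. l i \<in> S \<and> (\<lambda>n. u i (r n)) \<longlonglongrightarrow> l i)"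
  using assms(2,3)
proof (induction I)
  case empty
  show ?case using strict_mono_id by auto
next
  case (insert j I)
  then obtain r l where r: "strict_mono r" "\<And>i. i \<in> I \<Longrightarrow> l i \<in> S \<and> (\<lambda>n. u i (r n)) \<longlonglongrightarrow> l i"
    by (metis insertI2)
  have "\<forall>n. u j (r n) \<in> S"
    using insert.prems by auto
  then obtain lj r' where r': "lj \<in> S" "strict_mono r'" "((\<lambda>n. u j (r n)) \<circ> r') \<longlonglongrightarrow> lj"
    using \<open>compact S\<close> unfolding compact_def by metis
  have "(\<lambda>n. u i (r (r' n))) \<longlonglongrightarrow> l i" if "i \<in> I" for i
    using LIMSEQ_subseq_LIMSEQ[OF _ r'(2), of "\<lambda>n. u i (r n)" "l i"] r(2)[OF that]
    by (auto simp: o_def)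
  then have "\<forall>i\<in>insert j I. (l(j := lj)) i \<in> S \<and> (\<lambda>n. u i ((r \<circ> r') n)) \<longlonglongrightarrow> (l(j := lj)) i"
    using r r' insert.hyps by (auto simp: o_def)
  moreover have "strict_mono (r \<circ> r')"
    using r(1) r'(2) by (rule strict_mono_o)
  ultimately show ?case by blast
qed

text \<open>On the window from -K to 0 the backward Gronwall bound, with the uniform factor
  \<open>E\<close>, turns convergence at time 0 into uniform convergence of the shifted solutions.
  Their derivatives then converge uniformly too, since \<open>f\<close> is Lipschitz on
  \<open>S\<close>, so the limit is a solution.\<close>

lemma backward_solution_limit_segment:
  fixes f :: "'a::euclidean_space \<Rightarrow> 'a"
  assumes f: "L-lipschitz_on S f" and "compact S"
    and u: "ode_solution f {a..} u" "\<And>t. t \<ge> a \<Longrightarrow> u t \<in> S"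
    and \<tau>: "filterlim \<tau> at_top sequentially" "(\<lambda>n. u (\<tau> n)) \<longlonglongrightarrow> l"
    and "K \<ge> 0"
  shows "\<exists>\<phi>. \<phi> 0 = l \<and> ode_solution f {- K..0} \<phi> \<and> (\<forall>s\<in>{- K..0}. (\<lambda>n. u (\<tau> n + s)) \<longlonglongrightarrow> \<phi> s)"
proof -
  define E where "E = exp (L * K)"
  have "L \<ge> 0" using f by (rule lipschitz_on_nonneg)
  obtain N where N: "\<And>n. n \<ge> N \<Longrightarrow> \<tau> n \<ge> a + K"
    using filterlim_at_top[THEN iffD1, OF \<tau>(1), rule_format, of "a + K"]
    by (auto simp: eventually_sequentially)
  \<comment> \<open>Dropping the first \<open>N\<close> terms makes the whole window, shifted by any
    \<rho> n, lie in the domain of \<open>u\<close>.\<close>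
  define \<rho> where "\<rho> n = \<tau> (n + N)" for n
  have \<rho>: "\<rho> n \<ge> a + K" for n
    by (simp add: \<rho>_def N)
  have \<rho>_lim: "(\<lambda>n. u (\<rho> n)) \<longlonglongrightarrow> l"
    unfolding \<rho>_def using \<tau>(2) by (rule LIMSEQ_ignore_initial_segment)
  have sol: "ode_solution f J (\<lambda>s. u (\<rho> n + s))" if "J \<subseteq> {- K..0}" for n J
    by (rule ode_solution_shift[OF u(1)]) (use that \<rho>[of n] in force)
  have in_S: "u (\<rho> n + s) \<in> S" if "s \<in> {- K..0}" for n s
    using that \<rho>[of n] by (intro u(2)) auto
  have dist: "norm (u (\<rho> n + s) - u (\<rho> m + s)) \<le> E * norm (u (\<rho> n) - u (\<rho> m))"
    if s: "s \<in> {- K..0}" for n m s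
  proof -
    have "L * (0 - s) \<le> L * K"
      using s \<open>L \<ge> 0\<close> by (intro mult_left_mono) auto
    then have exp_le: "exp (L * (0 - s)) \<le> E"
      by (simp add: E_def)
    have "norm (u (\<rho> n + s) - u (\<rho> m + s)) \<le> exp (L * (0 - s)) * norm (u (\<rho> n + 0) - u (\<rho> m + 0))"
      by (rule ode_solution_dist_le(2)[OF f]) (use s in \<open>auto intro!: sol in_S\<close>)
    also have "\<dots> \<le> E * norm (u (\<rho> n) - u (\<rho> m))"
      unfolding add_0_right by (rule mult_right_mono[OF exp_le norm_ge_zero])
    finally show ?thesis .
  qed
  have "\<exists>c. (\<lambda>n. u (\<rho> n + s)) \<longlonglongrightarrow> c" if s: "s \<in> {- K..0}" for s
  proof -
    have "Cauchy (\<lambda>n. u (\<rho> n + s))"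
    proof (rule metric_CauchyI)
      fix e :: real assume "e > 0"
      then obtain M where "\<And>m n. m \<ge> M \<Longrightarrow> n \<ge> M \<Longrightarrow> dist (u (\<rho> m)) (u (\<rho> n)) < e / E"
        using metric_CauchyD[OF LIMSEQ_imp_Cauchy[OF \<rho>_lim], of "e / E"] by (auto simp: E_def)
      then have "dist (u (\<rho> m + s)) (u (\<rho> n + s)) < e" if "m \<ge> M" "n \<ge> M" for m n
        using dist[OF s, of m n] that by (fastforce simp: dist_norm E_def field_simps)
      then show "\<exists>M. \<forall>m\<ge>M. \<forall>n\<ge>M. dist (u (\<rho> m + s)) (u (\<rho> n + s)) < e" by blast
    qed
    then show ?thesis
      using Cauchy_convergent_iff convergent_def by blast
  qed
  then obtain \<phi> where \<phi>: "\<And>s. s \<in> {- K..0} \<Longrightarrow> (\<lambda>n. u (\<rho> n + s)) \<longlonglongrightarrow> \<phi> s"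
    by metis
  \<comment> \<open>Passing to the limit in \<open>m\<close> makes the distance to \<phi> small
    uniformly in \<open>s\<close>.\<close>
  have \<phi>_dist: "norm (u (\<rho> n + s) - \<phi> s) \<le> E * norm (u (\<rho> n) - l)" if s: "s \<in> {- K..0}" for n s
  proof (rule tendsto_le[OF trivial_limit_sequentially])
    show "(\<lambda>m. norm (u (\<rho> n + s) - u (\<rho> m + s))) \<longlonglongrightarrow> norm (u (\<rho> n + s) - \<phi> s)"
      by (intro tendsto_intros \<phi> s)
    show "(\<lambda>m. E * norm (u (\<rho> n) - u (\<rho> m))) \<longlonglongrightarrow> E * norm (u (\<rho> n) - l)"
      by (intro tendsto_intros \<rho>_lim)
  qed (use dist[OF s] in auto)
  have \<phi>_in_S: "\<phi> s \<in> S" if "s \<in> {- K..0}" for s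
    using closed_sequentially[OF compact_imp_closed[OF \<open>compact S\<close>] _ \<phi>[OF that]] in_S[OF that]
    by blast
  have "\<exists>g. \<forall>s\<in>{- K..0}. (\<lambda>n. u (\<rho> n + s)) \<longlonglongrightarrow> g s \<and>
      (g has_derivative (\<lambda>h. h *\<^sub>R f (\<phi> s))) (at s within {- K..0})"
  proof (rule has_derivative_sequence)
    show "((\<lambda>s. u (\<rho> n + s)) has_derivative (\<lambda>h. h *\<^sub>R f (u (\<rho> n + s)))) (at s within {- K..0})"
      if "s \<in> {- K..0}" for n s
      using sol[OF order_refl] that by (auto simp: ode_solution_def has_vector_derivative_def)
    show "\<forall>\<^sub>F n in sequentially. \<forall>s\<in>{- K..0}. \<forall>h.
        norm (h *\<^sub>R f (u (\<rho> n + s)) - h *\<^sub>R f (\<phi> s)) \<le> e * norm h" if "e > 0" for e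
    proof -
      have "(\<lambda>n. L * (E * norm (u (\<rho> n) - l))) \<longlonglongrightarrow> L * (E * norm (l - l))"
        by (intro tendsto_intros \<rho>_lim)
      then have "\<forall>\<^sub>F n in sequentially. L * (E * norm (u (\<rho> n) - l)) < e"
        using that by (intro order_tendstoD(2)) auto
      then show ?thesis
      proof eventually_elim
        case (elim n)
        show ?case
        proof (intro ballI allI)
          fix s h assume s: "s \<in> {- K..0}"
          have "norm (f (u (\<rho> n + s)) - f (\<phi> s)) \<le> L * norm (u (\<rho> n + s) - \<phi> s)"
            using lipschitz_onD[OF f in_S[OF s] \<phi>_in_S[OF s]] by (simp add: dist_norm)
          also have "\<dots> \<le> L * (E * norm (u (\<rho> n) - l))"
            using \<phi>_dist[OF s] \<open>L \<ge> 0\<close> by (rule mult_left_mono)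
          finally have "norm (f (u (\<rho> n + s)) - f (\<phi> s)) \<le> e" using elim by simp
          then show "norm (h *\<^sub>R f (u (\<rho> n + s)) - h *\<^sub>R f (\<phi> s)) \<le> e * norm h"
            by (simp add: scaleR_right_diff_distrib[symmetric] mult.commute[of e] mult_left_mono)
        qed
      qed
    qed
    show "(\<lambda>n. u (\<rho> n + 0)) \<longlonglongrightarrow> l" using \<rho>_lim by simp
  qed (use \<open>K \<ge> 0\<close> in auto)
  then obtain g where g: "\<And>s. s \<in> {- K..0} \<Longrightarrow> (\<lambda>n. u (\<rho> n + s)) \<longlonglongrightarrow> g s"
    "\<And>s. s \<in> {- K..0} \<Longrightarrow> (g has_vector_derivative f (\<phi> s)) (at s within {- K..0})"
    unfolding has_vector_derivative_def by blast
  \<comment> \<open>The limit \<open>g\<close> produced with the derivatives is again a pointwise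
    limit of the shifts, hence equal to \<phi>. This turns f (\<phi> s) into f (g s), closing the
    differential equation.\<close>
  have g_eq: "g s = \<phi> s" if "s \<in> {- K..0}" for s
    using LIMSEQ_unique[OF g(1) \<phi>] that by blast
  show ?thesis
  proof (intro exI conjI ballI)
    show "g 0 = l"
      using LIMSEQ_unique[OF g(1)[of 0]] \<rho>_lim \<open>K \<ge> 0\<close> by simp
    show "ode_solution f {- K..0} g"
      unfolding ode_solution_def using g(2) g_eq by auto
    show "(\<lambda>n. u (\<tau> n + s)) \<longlonglongrightarrow> g s" if "s \<in> {- K..0}" for s
      using g(1)[OF that] unfolding \<rho>_def by (rule LIMSEQ_offset)
  qed
qed

text \<open>Defining \<phi> by pointwise limits makes it independent of the window, so the segment
  solutions agree with it wherever they are defined and glue together.\<close>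

lemma backward_solution_limit:
  fixes f :: "'a::euclidean_space \<Rightarrow> 'a"
  assumes f: "local_lipschitz (UNIV :: real set) UNIV (\<lambda>_. f)" and "compact S"
    and u: "ode_solution f {a..} u" "\<And>t. t \<ge> a \<Longrightarrow> u t \<in> S"
    and \<tau>: "filterlim \<tau> at_top sequentially" "(\<lambda>n. u (\<tau> n)) \<longlonglongrightarrow> l"
  obtains \<phi> where "\<phi> 0 = l" "ode_solution f {..0} \<phi>" "\<And>s. s \<le> 0 \<Longrightarrow> (\<lambda>n. u (\<tau> n + s)) \<longlonglongrightarrow> \<phi> s"
proof -
  obtain L where L: "L-lipschitz_on S f"
    using local_lipschitz_autonomous_compact[OF f \<open>compact S\<close>] .
  define \<phi> where "\<phi> s = lim (\<lambda>n. u (\<tau> n + s))" for s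
  note segment = backward_solution_limit_segment[OF L \<open>compact S\<close> u \<tau>]
  show ?thesis
  proof
    show "\<phi> 0 = l" using limI[OF \<tau>(2)] by (simp add: \<phi>_def)
    show lim: "(\<lambda>n. u (\<tau> n + s)) \<longlonglongrightarrow> \<phi> s" if s: "s \<le> 0" for s
    proof -
      obtain \<psi> where "\<forall>s'\<in>{s..0}. (\<lambda>n. u (\<tau> n + s')) \<longlonglongrightarrow> \<psi> s'"
        using segment[of "- s"] s unfolding minus_minus by auto
      then show ?thesis
        using s unfolding \<phi>_def by (metis atLeastAtMost_iff limI order_refl)
    qed
    show "ode_solution f {..0} \<phi>"
      unfolding ode_solution_def
    proof
      fix s :: real assume "s \<in> {..0}"
      then have s: "s \<le> 0" by simp
      \<comment> \<open>Starting the window at s - 1 keeps \<open>s\<close> off its left end. Near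
        \<open>s\<close> the window and the half-line then coincide, even for s = 0, and the two
        one-sided notions of derivative agree.\<close>
      then obtain \<psi> where \<psi>: "ode_solution f {s - 1..0} \<psi>"
        "\<And>s'. s' \<in> {s - 1..0} \<Longrightarrow> (\<lambda>n. u (\<tau> n + s')) \<longlonglongrightarrow> \<psi> s'"
        using segment[of "1 - s"] by auto
      have eq: "\<psi> s' = \<phi> s'" if "s' \<in> {s - 1..0}" for s'
        using LIMSEQ_unique[OF \<psi>(2) lim] that by auto
      have eq_s: "\<psi> s = \<phi> s"
        using eq s by simp
      have "(\<psi> has_vector_derivative f (\<psi> s)) (at s within {s - 1..0})"
        using \<psi>(1) s by (simp add: ode_solution_def)
      then have "(\<phi> has_vector_derivative f (\<phi> s)) (at s within {s - 1..0})"
        unfolding eq_s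
        by (rule has_vector_derivative_transform[rotated 2]) (use s eq in auto)
      moreover have "at s within {s - 1..0} = at s within {..0}"
        by (rule at_within_nhd[of _ "{s - 1<..}"]) auto
      ultimately show "(\<phi> has_vector_derivative f (\<phi> s)) (at s within {..0})"
        by simp
    qed
  qed
qed

text \<open>A solution on the whole half-line of admissible times has no proper extension, so it is
  maximal with \<sigma> infinite.\<close>

lemma backward_indistI_global:
  assumes "ode_solution f {..0} \<phi>a" "ode_solution f {..0} \<phi>b"
    and "\<And>s. s \<le> 0 \<Longrightarrow> h (\<phi>a s) = h (\<phi>b s)"
  shows "backward_indist f h (\<phi>a 0) (\<phi>b 0)"
proof -
  have "backward_interval \<infinity> = {..0}"
    by (auto simp: backward_interval_def)
  moreover from this have "maximal_solution f {..0} (\<phi> 0) (backward_interval \<infinity>) \<phi>"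
    if "ode_solution f {..0} \<phi>" for \<phi>
    using that by (auto simp: maximal_solution_def is_interval_1)
  ultimately show ?thesis
    unfolding backward_indist_def using assms
    by (intro exI[of _ \<infinity>] exI[of _ \<phi>a] exI[of _ \<phi>b]) auto
qed

section \<open>The image of solutions under \<open>T\<close>, and the inclusion of fibers\<close>

lemma has_vector_derivative_map_along_solution:
  fixes T :: "real^'n \<Rightarrow> real^'m" and f :: "real^'n \<Rightarrow> real^'n"
  assumes T: "C1_map_on Om T DT" and "X \<subseteq> Om"
    and pde: "\<And>\<xi>. \<xi> \<in> X \<Longrightarrow> DT \<xi> *v f \<xi> = A *v T \<xi> + B *v h \<xi>"
    and u: "ode_solution f {a..} u" "\<And>t. t \<ge> a \<Longrightarrow> u t \<in> X"
    and "t > a"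
  shows "((\<lambda>t. T (u t)) has_vector_derivative A *v T (u t) + B *v h (u t)) (at t)"
proof -
  have "(u has_vector_derivative f (u t)) (at t within {a..})"
    using u(1) \<open>t > a\<close> by (auto simp: ode_solution_def)
  \<comment> \<open>\<open>T\<close> is differentiable only relative to \<open>Om\<close>; this
    suffices for the chain rule because the trajectory stays in \<open>Om\<close>.\<close>
  moreover have "(T has_derivative (\<lambda>v. DT (u t) *v v)) (at (u t) within u ` {a..})"
  proof (rule has_derivative_subset)
    show "(T has_derivative (\<lambda>v. DT (u t) *v v)) (at (u t) within Om)"
      using T u(2)[of t] \<open>t > a\<close> \<open>X \<subseteq> Om\<close> by (auto simp: C1_map_on_def)
    show "u ` {a..} \<subseteq> Om"
      using u(2) \<open>X \<subseteq> Om\<close> by auto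
  qed
  ultimately have "((\<lambda>t. T (u t)) has_vector_derivative DT (u t) *v f (u t)) (at t within {a..})"
    using vector_derivative_diff_chain_within[of u "f (u t)" t "{a..}" T] by (simp add: o_def)
  moreover have "at t within {a..} = at t"
    using \<open>t > a\<close> by (intro at_within_interior) simp
  ultimately show ?thesis
    using pde[OF u(2)[of t]] \<open>t > a\<close> by simp
qed

text \<open>A real \<open>c\<close> strictly between 0 and the limit inferior eventually bounds the
  distance from below, whereas equal limits would push it below \<open>c\<close>.\<close>

lemma Liminf_norm_diff_pos_imp_limits_distinct:
  fixes u v :: "real \<Rightarrow> 'a::real_normed_vector"
  assumes "Liminf at_top (\<lambda>t. ereal (norm (u t - v t))) > 0"
    and \<tau>: "filterlim \<tau> at_top sequentially"
    and "(\<lambda>n. u (\<tau> n)) \<longlonglongrightarrow> k" "(\<lambda>n. v (\<tau> n)) \<longlonglongrightarrow> l"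
  shows "k \<noteq> l"
proof
  assume "k = l"
  obtain c where c: "0 < ereal c" "ereal c < Liminf at_top (\<lambda>t. ereal (norm (u t - v t)))"
    using ereal_dense2[OF assms(1)] by (elim exE conjE)
  have "\<forall>\<^sub>F n in sequentially. norm (u (\<tau> n) - v (\<tau> n)) > c"
    using eventually_compose_filterlim[OF less_LiminfD[OF c(2)] \<tau>] by simp
  moreover have "(\<lambda>n. norm (u (\<tau> n) - v (\<tau> n))) \<longlonglongrightarrow> norm (k - l)"
    by (intro tendsto_intros assms)
  then have "\<forall>\<^sub>F n in sequentially. norm (u (\<tau> n) - v (\<tau> n)) < c"
    using c \<open>k = l\<close> by (intro order_tendstoD(2)) auto
  ultimately have "\<forall>\<^sub>F n in sequentially. False"
    by eventually_elim simp
  then show False by simp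
qed

theorem proposition2:
  fixes f :: "real^'n \<Rightarrow> real^'n"
    and h :: "real^'n \<Rightarrow> real^'k"
    and Om X :: "(real^'n) set"
    and A :: "real^'m^'m"
    and B :: "real^'k^'m"
    and T :: "real^'n \<Rightarrow> real^'m"
    and DT :: "real^'n \<Rightarrow> real^'n^'m"
    and p :: nat
    and y :: "real \<Rightarrow> real^'k"
    and tbar :: real
    and x :: "nat \<Rightarrow> real \<Rightarrow> real^'n"
  assumes f_lipschitz: "local_lipschitz (UNIV :: real set) UNIV (\<lambda>_. f)"
    and h_cont: "continuous_on UNIV h"
    and X_sub: "X \<subseteq> Om"
    and X_compact: "compact X"
    and A_hurwitz: "hurwitz A"
    and T_C1: "C1_map_on Om T DT"
    and T_pde: "\<forall>\<xi>\<in>X. DT \<xi> *v f \<xi> = A *v T \<xi> + B *v h \<xi>"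
    and p_pos: "p \<ge> 1"
    and card_fiber: "\<forall>z \<in> T ` X. card (fiber X T z) = p"
    and full_rank: "\<forall>\<xi>\<in>X. rank (DT \<xi>) = CARD('n)"
    and y_output: "system_output f h y"
    and tbar_pos: "tbar > 0"
    and x_sol: "\<forall>i\<in>{1..p}. ode_solution f {tbar..} (x i)"
    and x_in_X: "\<forall>i\<in>{1..p}. \<forall>t\<ge>tbar. x i t \<in> X"
    and x_output: "\<forall>i\<in>{1..p}. \<forall>t\<ge>tbar. h (x i t) = y t"
    and x_separated: "\<forall>i\<in>{1..p}. \<forall>j\<in>{1..p}. i \<noteq> j \<longrightarrow>
          Liminf at_top (\<lambda>t. ereal (norm (x i t - x j t))) > 0"
  shows "\<forall>\<xi> \<in> omega_limit f (x 1 tbar). fiber X T (T \<xi>) \<subseteq> indist_class f h X \<xi>"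
proof
  fix \<xi> assume "\<xi> \<in> omega_limit f (x 1 tbar)"
  moreover have one: "1 \<in> {1..p}" using p_pos by simp
  ultimately obtain \<theta> where \<theta>: "\<And>n. \<theta> n \<ge> tbar" "filterlim \<theta> at_top sequentially"
    "(\<lambda>n. x 1 (\<theta> n)) \<longlonglongrightarrow> \<xi>"
    using omega_limit_sequence[OF f_lipschitz] x_sol by metis
  \<comment> \<open>All \<open>p\<close> solutions are sampled along one subsequence of times; the
    limit for index 1 remains \<xi>.\<close>
  have "\<exists>r l. strict_mono (r :: nat \<Rightarrow> nat) \<and> (\<forall>i\<in>{1..p}. l i \<in> X \<and> (\<lambda>n. x i (\<theta> (r n))) \<longlonglongrightarrow> l i)"
    by (rule compact_common_subsequence[OF X_compact]) (use x_in_X \<theta>(1) in auto)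
  then obtain r l where r: "strict_mono (r :: nat \<Rightarrow> nat)"
    and l: "\<And>i. i \<in> {1..p} \<Longrightarrow> l i \<in> X" "\<And>i. i \<in> {1..p} \<Longrightarrow> (\<lambda>n. x i (\<theta> (r n))) \<longlonglongrightarrow> l i"
    by blast
  define \<tau> where "\<tau> n = \<theta> (r n)" for n
  have \<tau>: "filterlim \<tau> at_top sequentially" "\<And>n. \<tau> n \<ge> tbar"
    unfolding \<tau>_def using filterlim_compose[OF \<theta>(2) filterlim_subseq[OF r]] \<theta>(1) by auto
  note l_lim = l(2)[folded \<tau>_def]
  have l1: "l 1 = \<xi>"
    using LIMSEQ_unique[OF l(2)[OF one]] LIMSEQ_subseq_LIMSEQ[OF \<theta>(3) r] by (simp add: o_def)
  have T_cont: "continuous_on X T"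
    using T_C1 X_sub unfolding C1_map_on_def
    by (meson continuous_on_subset has_derivative_continuous_on)
  have T_lim: "(\<lambda>n. T (x i (\<tau> n))) \<longlonglongrightarrow> T (l i)" if i: "i \<in> {1..p}" for i
    by (rule continuous_on_tendsto_compose[OF T_cont l_lim[OF i] l(1)[OF i]])
       (use x_in_X \<tau>(2) i in auto)
  have T_l: "T (l i) = T \<xi>" if i: "i \<in> {1..p}" for i
  proof -
    have "((\<lambda>t. T (x i t) - T (x 1 t)) \<longlongrightarrow> 0) at_top"
    proof (rule hurwitz_decay[OF A_hurwitz])
      fix t assume t: "t > tbar"
      \<comment> \<open>The common output makes the input term \<open>B *v y t\<close> the same for
        every \<open>j\<close>, so it cancels in differences.\<close>
      have deriv: "((\<lambda>t. T (x j t)) has_vector_derivative A *v T (x j t) + B *v y t) (at t)"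
        if "j \<in> {1..p}" for j
        using has_vector_derivative_map_along_solution[OF T_C1 X_sub T_pde[rule_format], where u = "x j" and a = tbar and t = t]
          x_sol x_in_X x_output that t by auto
      show "((\<lambda>t. T (x i t) - T (x 1 t)) has_vector_derivative A *v (T (x i t) - T (x 1 t))) (at t)"
        using has_vector_derivative_diff[OF deriv[OF i] deriv[OF one]]
        by (simp add: matrix_vector_mult_diff_distrib)
    qed
    then have "(\<lambda>n. T (x i (\<tau> n)) - T (x 1 (\<tau> n))) \<longlonglongrightarrow> 0"
      using \<tau>(1) by (rule filterlim_compose)
    moreover have "(\<lambda>n. T (x i (\<tau> n)) - T (x 1 (\<tau> n))) \<longlonglongrightarrow> T (l i) - T (l 1)"
      by (intro tendsto_diff T_lim i one)
    ultimately show ?thesis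
      using LIMSEQ_unique l1 by fastforce
  qed
  have "inj_on l {1..p}"
  proof (rule inj_onI, rule ccontr)
    fix i j assume "i \<in> {1..p}" "j \<in> {1..p}" "l i = l j" "i \<noteq> j"
    then show False
      using Liminf_norm_diff_pos_imp_limits_distinct[OF _ \<tau>(1) l_lim l_lim] x_separated by blast
  qed
  then have "card (l ` {1..p}) = p"
    by (simp add: card_image)
  moreover have "card (fiber X T (T \<xi>)) = p"
    using card_fiber l(1)[OF one] l1 by blast
  moreover have "l ` {1..p} \<subseteq> fiber X T (T \<xi>)"
    using l(1) T_l by (auto simp: fiber_def)
  \<comment> \<open>An infinite set has cardinality 0, so p \<ge> 1 makes the fiber finite; a subset
    of equal cardinality is then the whole fiber.\<close>
  ultimately have fiber_eq: "fiber X T (T \<xi>) = l ` {1..p}"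
    using p_pos by (metis card.infinite card_subset_eq not_one_le_zero)
  have "backward_indist f h (l i) (l 1)" if i: "i \<in> {1..p}" for i
  proof -
    have backward: "\<exists>\<phi>. \<phi> 0 = l j \<and> ode_solution f {..0} \<phi> \<and> (\<forall>s\<le>0. (\<lambda>n. x j (\<tau> n + s)) \<longlonglongrightarrow> \<phi> s)"
      if j: "j \<in> {1..p}" for j
      by (rule backward_solution_limit[OF f_lipschitz X_compact _ _ \<tau>(1) l_lim[OF j]])
         (use x_sol x_in_X j in blast)+
    obtain \<phi> \<psi> where \<phi>: "\<phi> 0 = l i" "ode_solution f {..0} \<phi>" "\<And>s. s \<le> 0 \<Longrightarrow> (\<lambda>n. x i (\<tau> n + s)) \<longlonglongrightarrow> \<phi> s"
      and \<psi>: "\<psi> 0 = l 1" "ode_solution f {..0} \<psi>" "\<And>s. s \<le> 0 \<Longrightarrow> (\<lambda>n. x 1 (\<tau> n + s)) \<longlonglongrightarrow> \<psi> s"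
      using backward[OF i] backward[OF one] by blast
    have "h (\<phi> s) = h (\<psi> s)" if s: "s \<le> 0" for s
    proof (rule LIMSEQ_unique)
      have h_lim: "(\<lambda>n. h (v n)) \<longlonglongrightarrow> h c" if "v \<longlonglongrightarrow> c" for v c
        using continuous_on_tendsto_compose[OF h_cont that] by simp
      show "(\<lambda>n. h (x i (\<tau> n + s))) \<longlonglongrightarrow> h (\<phi> s)"
        by (rule h_lim[OF \<phi>(3)[OF s]])
      \<comment> \<open>The outputs agree only from \<open>tbar\<close> on, so for fixed
        \<open>s\<close> the index must be large enough that \<tau> n + s has passed
        \<open>tbar\<close>.\<close>
      have "\<forall>\<^sub>F n in sequentially. tbar - s \<le> \<tau> n"
        using \<tau>(1) by (simp add: filterlim_at_top)
      then have "\<forall>\<^sub>F n in sequentially. h (x 1 (\<tau> n + s)) = h (x i (\<tau> n + s))"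
        by eventually_elim (use x_output i one in auto)
      then show "(\<lambda>n. h (x i (\<tau> n + s))) \<longlonglongrightarrow> h (\<psi> s)"
        by (rule Lim_transform_eventually[OF h_lim[OF \<psi>(3)[OF s]]])
    qed
    from backward_indistI_global[of f \<phi> \<psi> h, OF \<phi>(2) \<psi>(2) this] show ?thesis
      by (simp add: \<phi>(1) \<psi>(1))
  qed
  then show "fiber X T (T \<xi>) \<subseteq> indist_class f h X \<xi>"
    unfolding fiber_eq indist_class_def using l(1) l1 by auto
qed

end
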